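(* Let $p$ be a prime and let $R$ be a non-commutative ring of order $p^2$. Then $|\operatorname{Cent}(R)| = p + 2$.
   Context: Rings are associative and not assumed to have a unity. For $r \in R$, the centralizer of $r$ is the subring $C(r) = \{s \in R : rs = sr\}$, and $\operatorname{Cent}(R) = \{C(r) : r \in R\}$ is the set of all distinct centralizers. *)

theory Defs
  imports "HOL-Computational_Algebra.Primes"
begin

(* The type class ring is associative and does not assume a unity. *)

definition centralizer :: "'a::ring \<Rightarrow> 'a set" where
  "centralizer r = {s. r * s = s * r}"

definition Cent :: "'a::ring itself \<Rightarrow> 'a set set" where
  "Cent _ = range centralizer"

end

theory Submission
  imports "HOL-Algebra.Coset" Defs
begin

text \<open>
  A centralizer is an additive subgroup, so by Lagrange's theorem a proper centralizer, which
  contains both \<open>0\<close> and its nonzero defining element, has exactly \<open>p\<close> elements. Subgroups of prime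
  order are either equal or meet only in \<open>0\<close>, so distinct proper centralizers intersect
  trivially. In particular a central element, which lies in the two distinct centralizers of a
  noncommuting pair, must be \<open>0\<close>; hence every nonzero element has a proper centralizer,
  and lies in it. The proper centralizers with \<open>0\<close> removed therefore partition the \<open>p\<^sup>2 - 1\<close>
  nonzero elements into blocks of size \<open>p - 1\<close>. This gives \<open>p + 1\<close> proper centralizers, and the
  centralizer of \<open>0\<close>, which is the whole ring, is one more.
\<close>

text \<open>
  Lagrange's theorem for the additive group of a type, obtained by viewing the type as a
  group record. Closure under subtraction is the form in which centralizers (and their
  intersections) are most easily seen to be subgroups.
\<close>
lemma card_additive_subgroup_dvd:
  fixes H :: "'a::ab_group_add set"
  assumes fin: "finite (UNIV :: 'a set)"
    and ne: "H \<noteq> {}"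
    and diff: "\<And>x y. x \<in> H \<Longrightarrow> y \<in> H \<Longrightarrow> x - y \<in> H"
  shows "card H dvd card (UNIV :: 'a set)"
proof -
  define G where "G = \<lparr>carrier = (UNIV :: 'a set), monoid.mult = ((+) :: 'a \<Rightarrow> 'a \<Rightarrow> 'a),
    one = 0 :: 'a\<rparr>"
  have G [simp]: "carrier G = UNIV" "x \<otimes>\<^bsub>G\<^esub> y = x + y" "\<one>\<^bsub>G\<^esub> = 0" for x y
    by (simp_all add: G_def)
  interpret group G
  proof (rule groupI)
    show "\<exists>y\<in>carrier G. y \<otimes>\<^bsub>G\<^esub> x = \<one>\<^bsub>G\<^esub>" for x
      by (auto intro!: exI[of _ "- x"])
  qed (simp_all add: add.assoc)
  have inv_G: "inv\<^bsub>G\<^esub> x = - x" for x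
    by (rule inv_equality) auto
  have zero: "0 \<in> H"
    using ne diff by fastforce
  have uminus: "- x \<in> H" if "x \<in> H" for x
    using diff[OF zero that] by simp
  have "subgroup H G"
  proof (rule subgroupI)
    show "x \<otimes>\<^bsub>G\<^esub> y \<in> H" if "x \<in> H" "y \<in> H" for x y
      using diff[OF that(1) uminus[OF that(2)]] by simp
  qed (use ne uminus inv_G in auto)
  from lagrange_finite[OF _ this] fin show ?thesis
    by (metis G(1) dvd_triv_right order_def)
qed

lemma zero_in_centralizer: "0 \<in> centralizer r"
  by (simp add: centralizer_def)

lemma self_in_centralizer: "r \<in> centralizer r"
  by (simp add: centralizer_def)

lemma diff_in_centralizer:
  "x \<in> centralizer r \<Longrightarrow> y \<in> centralizer r \<Longrightarrow> x - y \<in> centralizer r"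
  by (simp add: centralizer_def algebra_simps)

lemma centralizer_zero: "centralizer 0 = UNIV"
  by (simp add: centralizer_def)

context
  fixes p :: nat
  assumes p: "prime p"
    and card_ring: "card (UNIV :: 'a::ring set) = p ^ 2"
begin

lemma finite_ring: "finite (UNIV :: 'a set)"
  using p card_ring by (intro card_ge_0_finite) (simp add: prime_gt_0_nat)

lemma prime_dvd_card_nontrivial_subgroup:
  fixes H :: "'a set"
  assumes "0 \<in> H" "\<And>x y. x \<in> H \<Longrightarrow> y \<in> H \<Longrightarrow> x - y \<in> H"
    and "x \<in> H" "x \<noteq> 0"
  shows "p dvd card H"
proof -
  have "card H dvd p ^ 2"
    using card_additive_subgroup_dvd[OF finite_ring] assms card_ring by (metis empty_iff)
  then obtain i where i: "card H = p ^ i"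
    using p divides_primepow_nat by blast
  have "card {0, x} \<le> card H"
    using assms finite_subset[OF subset_UNIV finite_ring] by (intro card_mono) auto
  then have "i \<noteq> 0"
    using i assms(4) by (cases "i = 0") auto
  then show ?thesis
    using i by simp
qed

text \<open>
  By Lagrange the order is \<open>1\<close>, \<open>p\<close> or \<open>p\<^sup>2\<close>. The last would make the centralizer the whole
  ring. The first would leave only \<open>0\<close> in it, so \<open>r = 0\<close>, and \<open>0\<close> commutes with everything.
\<close>
lemma card_proper_centralizer:
  fixes r :: 'a
  assumes "centralizer r \<noteq> UNIV"
  shows "card (centralizer r) = p"
proof -
  have "r \<noteq> 0"
    using assms centralizer_zero by auto
  then have pd: "p dvd card (centralizer r)"
    by (intro prime_dvd_card_nontrivial_subgroup[where x = r])
      (auto simp: zero_in_centralizer self_in_centralizer diff_in_centralizer)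
  have "card (centralizer r) dvd p ^ 2"
    using card_additive_subgroup_dvd[OF finite_ring] diff_in_centralizer zero_in_centralizer
      card_ring by (metis empty_iff)
  then obtain i where i: "i \<le> 2" "card (centralizer r) = p ^ i"
    using p divides_primepow_nat by blast
  have "i \<noteq> 0"
    using i pd not_prime_unit p by (cases "i = 0") auto
  moreover have "i \<noteq> 2"
    using i card_ring assms finite_ring card_subset_eq[OF finite_ring subset_UNIV] by metis
  ultimately have "i = 1"
    using i by simp
  with i show ?thesis
    by simp
qed

text \<open>
  A nontrivial intersection is a subgroup with at least \<open>p\<close> elements inside two sets of
  exactly \<open>p\<close> elements, so it fills both of them.
\<close>
lemma distinct_proper_centralizers_meet_trivially:
  fixes r s :: 'a
  assumes r: "centralizer r \<noteq> UNIV" and s: "centralizer s \<noteq> UNIV"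
    and ne: "centralizer r \<noteq> centralizer s"
  shows "centralizer r \<inter> centralizer s = {0}"
proof (rule ccontr)
  let ?I = "centralizer r \<inter> centralizer s"
  assume "?I \<noteq> {0}"
  then obtain x where "x \<in> ?I" "x \<noteq> 0"
    using zero_in_centralizer by blast
  then have "p dvd card ?I"
    by (intro prime_dvd_card_nontrivial_subgroup[where x = x])
      (auto simp: zero_in_centralizer diff_in_centralizer)
  moreover have "card ?I > 0"
    using \<open>x \<in> ?I\<close> finite_subset[OF subset_UNIV finite_ring] card_gt_0_iff by blast
  ultimately have "p \<le> card ?I"
    by (rule dvd_imp_le)
  moreover have "A = B" if "A \<subseteq> B" "card B \<le> card A" for A B :: "'a set"
    using card_seteq[OF finite_subset[OF subset_UNIV finite_ring] that] .
  ultimately have "?I = centralizer r" "?I = centralizer s"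
    using card_proper_centralizer[OF r] card_proper_centralizer[OF s] by simp_all
  with ne show False
    by simp
qed

text \<open>
  The center is trivial: a central element lies in the centralizers of both \<open>a\<close> and \<open>b\<close>, which
  are proper and distinct because \<open>b\<close> belongs to its own centralizer but not to that of \<open>a\<close>.
\<close>
lemma centralizer_proper_if_nonzero:
  fixes a b r :: 'a
  assumes ab: "a * b \<noteq> b * a" and "r \<noteq> 0"
  shows "centralizer r \<noteq> UNIV"
proof
  assume "centralizer r = UNIV"
  then have "r * t = t * r" for t
    by (auto simp: centralizer_def)
  then have "r \<in> centralizer a \<inter> centralizer b"
    by (simp add: centralizer_def)
  moreover have b: "b \<notin> centralizer a" and a: "a \<notin> centralizer b"
    using ab by (auto simp: centralizer_def)
  have "centralizer a \<inter> centralizer b = {0}"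
    using a b self_in_centralizer[of b]
    by (intro distinct_proper_centralizers_meet_trivially) auto
  ultimately show False
    using \<open>r \<noteq> 0\<close> by simp
qed

text \<open>
  Every nonzero element lies in exactly one proper centralizer, namely its own. Counting the
  nonzero elements by the centralizer that contains them gives
  \<open>p\<^sup>2 - 1 = (p + 1) * (p - 1)\<close> as the number of proper centralizers times \<open>p - 1\<close>.
\<close>
lemma card_proper_centralizers:
  assumes "\<exists>a b :: 'a. a * b \<noteq> b * a"
  shows "card (range (centralizer :: 'a \<Rightarrow> _) - {UNIV}) = p + 1"
proof -
  let ?P = "range (centralizer :: 'a \<Rightarrow> _) - {UNIV}"
  have fin: "finite A" for A :: "'a set"
    using finite_subset[OF subset_UNIV finite_ring] .
  have block: "card (A - {0}) = p - 1" if A: "A \<in> ?P" for A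
  proof -
    obtain r where r: "A = centralizer r" "centralizer r \<noteq> UNIV"
      using A by blast
    show ?thesis
      unfolding r(1) card_Diff_singleton[OF zero_in_centralizer]
        card_proper_centralizer[OF r(2)] ..
  qed
  have disjoint: "A \<inter> B = {0}" if "A \<in> ?P" "B \<in> ?P" "A \<noteq> B" for A B
    using that distinct_proper_centralizers_meet_trivially by auto
  have cover: "(\<Union>A\<in>?P. A - {0}) = UNIV - {0}"
  proof -
    have "r \<in> (\<Union>A\<in>?P. A - {0})" if "r \<noteq> 0" for r :: 'a
    proof (rule UN_I)
      show "centralizer r \<in> ?P"
        using assms centralizer_proper_if_nonzero \<open>r \<noteq> 0\<close> by auto
      show "r \<in> centralizer r - {0}"
        using self_in_centralizer \<open>r \<noteq> 0\<close> by simp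
    qed
    then show ?thesis
      by (intro equalityI subsetI) auto
  qed
  have "p ^ 2 - 1 = card (\<Union>A\<in>?P. A - {0})"
    unfolding cover using card_ring by (simp add: card_Diff_singleton)
  also have "\<dots> = (\<Sum>A\<in>?P. card (A - {0}))"
  proof (rule card_UN_disjoint)
    show "finite ?P"
      using finite_ring by simp
    show "\<forall>A\<in>?P. \<forall>B\<in>?P. A \<noteq> B \<longrightarrow> (A - {0}) \<inter> (B - {0}) = {}"
      using disjoint by blast
    show "\<forall>A\<in>?P. finite (A - {0})"
      using fin by simp
  qed
  also have "\<dots> = card ?P * (p - 1)"
    using block by (simp only: sum_constant of_nat_id cong: sum.cong)
  also have "p ^ 2 - 1 = (p + 1) * (p - 1)"
    by (simp add: algebra_simps power2_eq_square)
  finally have "card ?P * (p - 1) = (p + 1) * (p - 1)" ..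
  then show ?thesis
    using prime_gt_1_nat[OF p] by (subst (asm) mult_cancel2) auto
qed

end

theorem theorem2p9:
  fixes p :: nat
  assumes "prime p"
    and "card (UNIV :: 'a::ring set) = p ^ 2"
    and "\<exists>a b :: 'a. a * b \<noteq> b * a"
  shows "card (Cent TYPE('a)) = p + 2"
proof -
  let ?C = "range (centralizer :: 'a \<Rightarrow> _)"
  have "UNIV \<in> ?C"
    using centralizer_zero by (metis rangeI)
  moreover have "finite ?C"
    using finite_ring[OF assms(1,2)] by simp
  ultimately have "card ?C = Suc (card (?C - {UNIV}))"
    by (simp only: card.remove)
  then show ?thesis
    using card_proper_centralizers[OF assms] by (simp add: Cent_def)
qed

end
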